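(* Let $P$ be a monic polynomial of degree $n$ with coefficients in $K$. Assume that $\pi^s\mid P(X)$ for all $X\in\mathcal{O}_K$. Then $n\ge\beta(s)$. Furthermore, if $P=\sum_i P_iX^i$ is a power series (with coefficients in $K$, converging on $\mathcal{O}_{\mathbf{C}_p}$) with the same property, i.e. $\pi^s\mid P(X)$ for all $X\in\mathcal{O}_K$, and the coefficient $P_{\mathrm{Lwideg}(P)}$ is a unit, then $\mathrm{Lwideg}(P)\ge\beta(s)$.
   Context: $p$ is a prime; $K$ is a finite extension of $\mathbf{Q}_p$ with residue degree $f$, ring of integers $\mathcal{O}_K$ and uniformizer $\pi$; $\mathcal{O}_{\mathbf{C}_p}$ is the closed unit disc of $\mathbf{C}_p$ (the completion of $\overline{\mathbf{Q}}_p$); $s$ is a non-negative integer; $\pi^s\mid y$ means $y\in\pi^s\mathcal{O}_K$. For a power series $P=\sum P_iX^i$ converging on $\mathcal{O}_{\mathbf{C}_p}$, $\mathrm{Lwideg}(P)$ is the largest index $N$ with $v_p(P_N)=\min_i v_p(P_i)$. Numerical functions: $\alpha(j)=\sum_{k\ge1}\lfloor j/p^{kf}\rfloor$ and $\beta(m)=\min\{j:\alpha(j)\ge m\}$. *)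

theory Defs
  imports
    "HOL-Analysis.Analysis"
    "HOL-Computational_Algebra.Formal_Power_Series"
    "HOL-Algebra.Algebraic_Closure_Type"
begin

definition padic_abs_rat :: "nat \<Rightarrow> rat \<Rightarrow> real" where
  "padic_abs_rat p r =
     (if r = 0 then 0
      else case quotient_of r of (a, b) \<Rightarrow>
        real p powi (int (multiplicity (int p) b) - int (multiplicity (int p) a)))"

text \<open>
  The field of complex p-adic numbers is represented by a type variable: a field of
  characteristic 0 that is a complete metric space.  The absolute value is the distance to 0.
\<close>

definition absval :: "'c::{zero,metric_space} \<Rightarrow> real" where
  "absval x = dist x 0"

definition Qp :: "'c::{field_char_0,metric_space} set" where
  "Qp = closure \<rat>"

text \<open>
  \<open>is_Cp p TYPE('c)\<close>: the metric comes from a multiplicative ultrametric absolute value that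
  restricts to the p-adic one on the rationals, so that the closure of the rationals in the
  complete space \<open>'c\<close> is the field of p-adic numbers; and \<open>'c\<close> is the completion
  of an algebraic closure of that field, i.e. it is complete (by its sort) and contains an
  algebraic closure as a dense subfield.
\<close>

definition is_Cp :: "nat \<Rightarrow> 'c::{field_char_0,complete_space} itself \<Rightarrow> bool" where
  "is_Cp p _ \<longleftrightarrow>
     (\<forall>x y :: 'c. dist x y = absval (x - y)) \<and>
     (\<forall>x y :: 'c. absval (x * y) = absval x * absval y) \<and>
     (\<forall>x y :: 'c. absval (x + y) \<le> max (absval x) (absval y)) \<and>
     (\<forall>r. absval (of_rat r :: 'c) = padic_abs_rat p r) \<and>
     (\<exists>A :: 'c set. algebraic_closure (ring_of_type_algebra\<lparr>carrier := A\<rparr>) Qp \<and> closure A = UNIV)"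

definition finite_extension_of_Qp :: "'c::{field_char_0,metric_space} set \<Rightarrow> bool" where
  "finite_extension_of_Qp K \<longleftrightarrow>
     subfield K ring_of_type_algebra \<and> Qp \<subseteq> K \<and>
     ring.finite_dimension ring_of_type_algebra Qp K"

definition integers_of :: "'c::{field_char_0,metric_space} set \<Rightarrow> 'c set" where
  "integers_of K = {x \<in> K. absval x \<le> 1}"

definition maximal_ideal_of :: "'c::{field_char_0,metric_space} set \<Rightarrow> 'c set" where
  "maximal_ideal_of K = {x \<in> K. absval x < 1}"

definition integer_ring :: "'c::{field_char_0,metric_space} set \<Rightarrow> 'c ring" where
  "integer_ring K = ring_of_type_algebra\<lparr>carrier := integers_of K\<rparr>"

definition residue_field :: "'c::{field_char_0,metric_space} set \<Rightarrow> 'c set ring" where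
  "residue_field K = integer_ring K Quot maximal_ideal_of K"

text \<open>
  The residue degree is the dimension of the residue field over its prime field; the latter
  is the image of the integers.
\<close>

definition has_residue_degree :: "'c::{field_char_0,metric_space} set \<Rightarrow> nat \<Rightarrow> bool" where
  "has_residue_degree K f \<longleftrightarrow>
     ring.dimension (residue_field K) f
       (range (\<lambda>n::int. [n] \<cdot>\<^bsub>residue_field K\<^esub> \<one>\<^bsub>residue_field K\<^esub>))
       (carrier (residue_field K))"

definition uniformizer :: "'c::{field_char_0,metric_space} set \<Rightarrow> 'c \<Rightarrow> bool" where
  "uniformizer K \<pi> \<longleftrightarrow>
     \<pi> \<in> integers_of K \<and> maximal_ideal_of K = {\<pi> * z | z. z \<in> integers_of K}"

definition dvd_in_integers :: "'c::{field_char_0,metric_space} set \<Rightarrow> 'c \<Rightarrow> 'c \<Rightarrow> bool" where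
  "dvd_in_integers K a y \<longleftrightarrow> (\<exists>z \<in> integers_of K. y = a * z)"

definition vp :: "nat \<Rightarrow> 'c::{zero,metric_space} \<Rightarrow> ereal" where
  "vp p x = (if x = 0 then \<infinity> else ereal (- log (real p) (absval x)))"

definition converges_on_unit_disc :: "'c::{field_char_0,metric_space} fps \<Rightarrow> bool" where
  "converges_on_unit_disc P \<longleftrightarrow>
     (\<forall>x. absval x \<le> 1 \<longrightarrow> summable (\<lambda>i. fps_nth P i * x ^ i))"

definition fps_value :: "'c::{field_char_0,metric_space} fps \<Rightarrow> 'c \<Rightarrow> 'c" where
  "fps_value P x = (\<Sum>i. fps_nth P i * x ^ i)"

text \<open>
  For a nonzero series converging on the closed unit disc the infimum is a minimum, attained
  at finitely many indices.  For the zero series the value is unspecified.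
\<close>

definition Lwideg :: "nat \<Rightarrow> 'c::{zero,metric_space} fps \<Rightarrow> nat" where
  "Lwideg p P = (GREATEST N. vp p (fps_nth P N) = (INF i. vp p (fps_nth P i)))"

text \<open>For \<open>p \<ge> 2\<close> and \<open>f \<ge> 1\<close> only finitely many terms of the sum are nonzero.\<close>

definition alpha :: "nat \<Rightarrow> nat \<Rightarrow> nat \<Rightarrow> nat" where
  "alpha p f j = (\<Sum>k. j div p ^ (Suc k * f))"

definition beta :: "nat \<Rightarrow> nat \<Rightarrow> nat \<Rightarrow> nat" where
  "beta p f m = (LEAST j. alpha p f j \<ge> m)"

end

theory Submission
  imports Defs
begin

text \<open>
  Both bounds follow from one computation with divided differences.  For distinct points
  \<open>x\<^sub>0, \<dots>, x\<^sub>n\<close> of the unit disc, the functional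
  \<open>D g = (\<Sum>j. g x\<^sub>j / (\<Prod>i\<noteq>j. x\<^sub>j - x\<^sub>i))\<close> kills \<open>X ^ i\<close> for \<open>i < n\<close>, takes \<open>X ^ n\<close>
  to 1, and takes every power of \<open>X\<close> into the unit disc.  Hence \<open>D P\<close> has absolute value 1
  whenever the coefficient of index \<open>n\<close> is a unit and all later ones have absolute value
  less than 1.  A monic polynomial of degree \<open>n\<close> is such a \<open>P\<close>, whatever its lower
  coefficients are; so is a power series with \<open>n = Lwideg P\<close>, or rather a truncation of it
  so long that the tail is divisible by \<open>\<pi> ^ s\<close>.

  On the other hand, if \<open>\<pi> ^ s\<close> divides all values of \<open>P\<close>, each summand of \<open>D P\<close> has absolute
  value at most \<open>\<bar>\<pi>\<bar> ^ s / \<bar>\<Prod>i\<noteq>j. x\<^sub>j - x\<^sub>i\<bar>\<close>.  So the points should be as far apart as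
  possible.  With \<open>q = p ^ f\<close>, take representatives of \<open>q\<close> residue classes as digits, and let
  \<open>x\<^sub>i\<close> be the number whose \<open>\<pi>\<close>-adic digits are the base \<open>q\<close> digits of \<open>i\<close>.  Then
  \<open>x\<^sub>i - x\<^sub>j\<close> is divisible by \<open>\<pi>\<close> at most as often as \<open>i - j\<close> is by \<open>q\<close>
  (\<open>digit_expansion_separated\<close>).  By the analogue of Legendre's formula,
  \<open>alpha p f n\<close> is the sum of the multiplicities of \<open>q\<close> in \<open>1, \<dots>, n\<close>, and this sum is
  superadditive in \<open>n\<close>; therefore every product has absolute value at least
  \<open>\<bar>\<pi>\<bar> ^ alpha p f n\<close> (\<open>prod_digit_expansion_differences_ge\<close>).  Comparing the two estimates gives
  \<open>s \<le> alpha p f n\<close> (\<open>polynomial_small_values_bound\<close>), that is \<open>beta p f s \<le> n\<close>.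

  What remains is to supply the \<open>q\<close> digits, which means counting the residue field from its
  dimension over the prime field (\<open>residue_representatives\<close>), and to read off from the
  definition of \<open>Lwideg\<close> that later coefficients are smaller
  (\<open>absval_less_beyond_Lwideg\<close>).
\<close>

section \<open>Divided differences\<close>

text \<open>
  The classical divided difference of \<open>g\<close> at the nodes \<open>S\<close>, in its symmetric form.  Equivalently,
  it is the coefficient of degree \<open>card S - 1\<close> of the polynomial interpolating \<open>g\<close> on \<open>S\<close>.
\<close>

definition divided_difference :: "'a::field set \<Rightarrow> ('a \<Rightarrow> 'a) \<Rightarrow> 'a" where
  "divided_difference S g = (\<Sum>x\<in>S. g x / (\<Prod>y\<in>S - {x}. x - y))"

lemma divided_difference_empty [simp]: "divided_difference {} g = 0"
  by (simp add: divided_difference_def)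

lemma divided_difference_add:
  "divided_difference S (\<lambda>x. g x + h x) = divided_difference S g + divided_difference S h"
  by (simp add: divided_difference_def add_divide_distrib sum.distrib)

lemma divided_difference_cmult:
  "divided_difference S (\<lambda>x. c * g x) = c * divided_difference S g"
  by (simp add: divided_difference_def sum_distrib_left)

lemma divided_difference_sum:
  "divided_difference S (\<lambda>x. \<Sum>i\<in>I. g i x) = (\<Sum>i\<in>I. divided_difference S (g i))"
  unfolding divided_difference_def sum_divide_distrib by (rule sum.swap)

lemma divided_difference_linear_factor:
  assumes "finite S" "a \<in> S"
  shows "divided_difference S (\<lambda>x. (x - a) * g x) = divided_difference (S - {a}) g"
proof -
  have "(x - a) * g x / (\<Prod>y\<in>S - {x}. x - y) = g x / (\<Prod>y\<in>S - {a} - {x}. x - y)"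
    if "x \<in> S - {a}" for x
  proof -
    have "S - {x} = insert a (S - {a} - {x})"
      using that assms by auto
    then have "(\<Prod>y\<in>S - {x}. x - y) = (x - a) * (\<Prod>y\<in>S - {a} - {x}. x - y)"
      using assms by simp
    then show ?thesis
      using that by simp
  qed
  then show ?thesis
    using assms by (simp add: divided_difference_def sum.remove)
qed

text \<open>
  This recursion, from \<open>X ^ Suc i = a * X ^ i + (X - a) * X ^ i\<close>, reduces every
  statement about powers below to smaller exponents and smaller sets of nodes.
\<close>

lemma divided_difference_power_Suc:
  assumes "finite S" "a \<in> S"
  shows "divided_difference S (\<lambda>x. x ^ Suc i) =
    a * divided_difference S (\<lambda>x. x ^ i) + divided_difference (S - {a}) (\<lambda>x. x ^ i)"
proof -
  have "(\<lambda>x. x ^ Suc i) = (\<lambda>x. a * x ^ i + (x - a) * x ^ i)"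
    by (simp add: algebra_simps)
  then show ?thesis
    using divided_difference_linear_factor[OF assms]
    by (simp only: divided_difference_add divided_difference_cmult)
qed

text \<open>
  The base of that recursion.  If \<open>S\<close> has two distinct nodes \<open>a\<close> and \<open>b\<close>, the divided
  differences of \<open>X - a\<close> and \<open>X - b\<close> are those of 1 on \<open>S - {a}\<close> and \<open>S - {b}\<close>, which agree by
  induction; so the divided difference of 1 is multiplied by \<open>a\<close> and by \<open>b\<close> with the same result.
\<close>

lemma divided_difference_one:
  assumes "finite S"
  shows "divided_difference S (\<lambda>x. 1) = (if card S = 1 then 1 else 0)"
  using assms
proof (induction "card S" arbitrary: S rule: less_induct)
  case less
  show ?case
  proof (cases "card S \<le> 1")
    case True
    then consider "S = {}" | a where "S = {a}"
      using less.prems by (metis card_0_eq card_1_singletonE le_neq_implies_less less_one)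
    then show ?thesis
      by cases (simp_all add: divided_difference_def)
  next
    case False
    then obtain a b where ab: "a \<in> S" "b \<in> S" "a \<noteq> b"
      by (metis One_nat_def card_le_Suc0_iff_eq less.prems)
    have removed: "divided_difference (S - {c}) (\<lambda>x. 1) = (if card S = 2 then 1 else 0)"
      and shifted: "divided_difference (S - {c}) (\<lambda>x. 1) =
          divided_difference S (\<lambda>x. x) - c * divided_difference S (\<lambda>x. 1)"
      if "c \<in> S" for c
    proof -
      have "card (S - {c}) = card S - 1"
        using that less.prems by simp
      then show "divided_difference (S - {c}) (\<lambda>x. 1) = (if card S = 2 then 1 else 0)"
        using less.hyps[of "S - {c}"] less.prems False by auto
      show "divided_difference (S - {c}) (\<lambda>x. 1) =
          divided_difference S (\<lambda>x. x) - c * divided_difference S (\<lambda>x. 1)"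
        using divided_difference_power_Suc[OF less.prems that, of 0] by simp
    qed
    have "a * divided_difference S (\<lambda>x. 1) = b * divided_difference S (\<lambda>x. 1)"
      using removed[OF ab(1)] removed[OF ab(2)] shifted[OF ab(1)] shifted[OF ab(2)]
      by (metis diff_left_imp_eq)
    then show ?thesis
      using ab False by simp
  qed
qed

lemma divided_difference_power:
  assumes "finite S" "i < card S"
  shows "divided_difference S (\<lambda>x. x ^ i) = (if Suc i = card S then 1 else 0)"
  using assms
proof (induction i arbitrary: S)
  case 0
  then show ?case
    by (simp add: divided_difference_one)
next
  case (Suc i)
  then obtain a where a: "a \<in> S"
    by fastforce
  show ?case
    unfolding divided_difference_power_Suc[OF Suc.prems(1) a]
    using Suc.IH[of S] Suc.IH[of "S - {a}"] Suc.prems a by auto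
qed

section \<open>A Legendre formula for alpha\<close>

text \<open>
  Passing from \<open>n\<close> to \<open>Suc n\<close> raises \<open>n div q ^ Suc k\<close> by one for exactly those \<open>k\<close> with
  \<open>q ^ Suc k dvd Suc n\<close>, and there are \<open>multiplicity q (Suc n)\<close> of them.
\<close>

lemma sum_multiplicity_eq_sum_div:
  fixes q :: nat
  assumes "2 \<le> q" "n \<le> M"
  shows "(\<Sum>d=1..n. multiplicity q d) = (\<Sum>k<M. n div q ^ Suc k)"
  using assms(2)
proof (induction n)
  case (Suc n)
  let ?w = "multiplicity q (Suc n)"
  have q: "\<not> is_unit q"
    using assms(1) by simp
  \<comment> \<open>The range of \<open>k\<close> is long enough to contain all these indices.\<close>
  have "?w < q ^ ?w"
    using assms(1) by (intro power_gt_expt) simp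
  also have "\<dots> \<le> Suc n"
    by (intro dvd_imp_le multiplicity_dvd) simp
  finally have "?w \<le> M"
    using Suc.prems by simp
  have "(\<Sum>k<M. Suc n div q ^ Suc k) =
      (\<Sum>k<M. n div q ^ Suc k + (if k < ?w then 1 else 0))"
  proof (intro sum.cong refl)
    fix k
    have "q ^ Suc k dvd Suc n \<longleftrightarrow> k < ?w"
      using power_dvd_iff_le_multiplicity[of "Suc n" q "Suc k"] q
      by (simp add: Suc_le_eq del: power_Suc)
    then show "Suc n div q ^ Suc k = n div q ^ Suc k + (if k < ?w then 1 else 0)"
      by (simp add: div_Suc mod_eq_0_iff_dvd)
  qed
  also have "\<dots> = (\<Sum>k<M. n div q ^ Suc k) + card {k. k < M \<and> k < ?w}"
    by (simp add: sum.distrib sum.If_cases Int_def lessThan_def)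
  also have "{k. k < M \<and> k < ?w} = {..<?w}"
    using \<open>?w \<le> M\<close> by auto
  finally show ?case
    using Suc by simp
qed simp

lemma sum_multiplicity_superadditive:
  fixes q :: nat
  assumes "2 \<le> q"
  shows "(\<Sum>d=1..m. multiplicity q d) + (\<Sum>d=1..n. multiplicity q d)
    \<le> (\<Sum>d=1..m + n. multiplicity q d)"
proof -
  have "m div a + n div a \<le> (m + n) div a" for a :: nat
    using div_add1_eq[of m n a] by linarith
  then show ?thesis
    using assms sum_multiplicity_eq_sum_div[of q _ "m + n"]
    by (simp add: sum_mono flip: sum.distrib)
qed

lemma alpha_eq_sum_multiplicity:
  assumes "2 \<le> p ^ f"
  shows "alpha p f n = (\<Sum>d=1..n. multiplicity (p ^ f) d)"
proof -
  have power_eq: "p ^ (Suc k * f) = (p ^ f) ^ Suc k" for k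
    by (simp only: power_mult[symmetric] mult.commute)
  have "n div p ^ (Suc k * f) = 0" if "k \<ge> n" for k
  proof -
    have "Suc k < (p ^ f) ^ Suc k"
      using assms by (intro power_gt_expt) simp
    then show ?thesis
      unfolding power_eq using that by (intro div_less) linarith
  qed
  then have "alpha p f n = (\<Sum>k<n. n div p ^ (Suc k * f))"
    unfolding alpha_def by (intro suminf_finite) auto
  then show ?thesis
    using sum_multiplicity_eq_sum_div[OF assms order_refl] by (simp only: power_eq)
qed

section \<open>Digit expansions and non-Archimedean absolute values\<close>

text \<open>
  The number whose first \<open>M\<close> digits with respect to \<open>t\<close> are the base \<open>q\<close> digits of \<open>i\<close>, lowest
  first, each replaced by the representative that \<open>r\<close> assigns to it.  The bound on the number of
  digits keeps the sum finite even if \<open>r 0 \<noteq> 0\<close>, when leading zeros contribute.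
\<close>

primrec digit_expansion :: "nat \<Rightarrow> 'a::comm_semiring_1 \<Rightarrow> (nat \<Rightarrow> 'a) \<Rightarrow> nat \<Rightarrow> nat \<Rightarrow> 'a" where
  "digit_expansion q t r 0 i = 0"
| "digit_expansion q t r (Suc M) i = r (i mod q) + t * digit_expansion q t r M (i div q)"

lemma digit_expansion_closed:
  assumes "0 < q" "0 \<in> R" "t \<in> R" "\<And>a. a < q \<Longrightarrow> r a \<in> R"
    and "\<And>x y. x \<in> R \<Longrightarrow> y \<in> R \<Longrightarrow> x + y \<in> R"
    and "\<And>x y. x \<in> R \<Longrightarrow> y \<in> R \<Longrightarrow> x * y \<in> R"
  shows "digit_expansion q t r M i \<in> R"
  using assms by (induction M arbitrary: i) simp_all

locale nonarchimedean_absolute_value =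
  fixes N :: "'a::field \<Rightarrow> real"
  assumes nonneg: "0 \<le> N x"
    and eq_zero_iff: "N x = 0 \<longleftrightarrow> x = 0"
    and mult: "N (x * y) = N x * N y"
    and ultrametric: "N (x + y) \<le> max (N x) (N y)"
begin

lemma zero [simp]: "N 0 = 0"
  by (simp add: eq_zero_iff)

lemma one [simp]: "N 1 = 1"
  using mult[of 1 1] eq_zero_iff[of 1] by simp

lemma minus [simp]: "N (- x) = N x"
proof -
  have "(N (- 1))\<^sup>2 = 1"
    using mult[of "-1" "-1"] by (simp add: power2_eq_square)
  then have "N (- 1) = 1"
    using nonneg[of "-1"] by (simp add: power2_eq_1_iff)
  then show ?thesis
    using mult[of "-1" x] by simp
qed

lemma diff_le: "N (x - y) \<le> max (N x) (N y)"
  using ultrametric[of x "- y"] by simp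

lemma power: "N (x ^ n) = N x ^ n"
  by (induction n) (simp_all add: mult)

lemma prod: "N (prod f S) = (\<Prod>x\<in>S. N (f x))"
  by (induction S rule: infinite_finite_induct) (simp_all add: mult)

lemma divide: "N (x / y) = N x / N y"
proof (cases "y = 0")
  case False
  then have "N (x / y) * N y = N x"
    by (simp flip: mult)
  then show ?thesis
    using False eq_zero_iff[of y] by (simp add: field_simps)
qed simp

lemma sum_le:
  assumes "\<And>x. x \<in> S \<Longrightarrow> N (f x) \<le> B" "0 \<le> B"
  shows "N (sum f S) \<le> B"
  using assms
proof (induction S rule: infinite_finite_induct)
  case (insert x F)
  then have "N (f x) \<le> B" "N (sum f F) \<le> B"
    by auto
  then show ?case
    using insert.hyps ultrametric[of "f x" "sum f F"] by simp
qed simp_all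

lemma sum_less:
  assumes "\<And>x. x \<in> S \<Longrightarrow> N (f x) < B" "0 < B"
  shows "N (sum f S) < B"
  using assms
proof (induction S rule: infinite_finite_induct)
  case (insert x F)
  then have "N (f x) < B" "N (sum f F) < B"
    by auto
  then show ?case
    using insert.hyps ultrametric[of "f x" "sum f F"] by simp
qed simp_all

lemma divided_difference_power_le_1:
  assumes "finite S" "\<And>x. x \<in> S \<Longrightarrow> N x \<le> 1"
  shows "N (divided_difference S (\<lambda>x. x ^ i)) \<le> 1"
  using assms
proof (induction i arbitrary: S)
  case 0
  then show ?case
    by (simp add: divided_difference_one)
next
  case (Suc i)
  show ?case
  proof (cases "S = {}")
    case False
    then obtain a where a: "a \<in> S"
      by blast
    have "N (a * divided_difference S (\<lambda>x. x ^ i)) \<le> 1"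
      using Suc.IH[of S] Suc.prems a by (simp add: mult mult_le_one nonneg)
    moreover have "N (divided_difference (S - {a}) (\<lambda>x. x ^ i)) \<le> 1"
      using Suc.IH[of "S - {a}"] Suc.prems by simp
    ultimately show ?thesis
      unfolding divided_difference_power_Suc[OF Suc.prems(1) a]
      using ultrametric by (smt (verit))
  qed simp
qed

text \<open>
  The leading part \<open>c n\<close> has absolute value 1 and everything else that survives is smaller.
  The terms below \<open>n\<close>, however large their coefficients, are killed by the functional.
\<close>

lemma divided_difference_polynomial_ge_1:
  assumes "finite S" "card S = Suc n" "\<And>x. x \<in> S \<Longrightarrow> N x \<le> 1"
    and "n \<le> M" "N (c n) = 1" "\<And>i. n < i \<Longrightarrow> i \<le> M \<Longrightarrow> N (c i) < 1"
  shows "1 \<le> N (divided_difference S (\<lambda>x. \<Sum>i\<le>M. c i * x ^ i))"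
proof -
  let ?D = "\<lambda>i. divided_difference S (\<lambda>x. x ^ i)"
  let ?rest = "\<Sum>i\<in>{n<..M}. c i * ?D i"
  have "divided_difference S (\<lambda>x. \<Sum>i\<le>M. c i * x ^ i) = (\<Sum>i\<le>M. c i * ?D i)"
    by (simp add: divided_difference_sum divided_difference_cmult)
  also have "\<dots> = (\<Sum>i\<in>{n..M}. c i * ?D i)"
    using assms(1,2) by (intro sum.mono_neutral_right) (auto simp: divided_difference_power)
  also have "\<dots> = c n + ?rest"
    using assms(1,2,4) by (simp add: sum.head divided_difference_power)
  finally have expansion: "divided_difference S (\<lambda>x. \<Sum>i\<le>M. c i * x ^ i) = c n + ?rest" .
  have "N (c i * ?D i) < 1" if "i \<in> {n<..M}" for i
  proof -
    have "N (c i) * N (?D i) \<le> N (c i) * 1"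
      using divided_difference_power_le_1[of S i] assms(1,3) by (intro mult_left_mono nonneg) auto
    then show ?thesis
      using that assms(6)[of i] by (simp add: mult)
  qed
  then have "N ?rest < 1"
    by (intro sum_less) auto
  then show ?thesis
    using diff_le[of "c n + ?rest" ?rest] assms(5) unfolding expansion by simp
qed

lemma digit_expansion_le_1:
  assumes "0 < q" "N t \<le> 1" "\<And>a. a < q \<Longrightarrow> N (r a) \<le> 1"
  shows "N (digit_expansion q t r M i) \<le> 1"
proof (induction M arbitrary: i)
  case (Suc M)
  have "N (t * digit_expansion q t r M (i div q)) \<le> 1"
    using Suc.IH assms(2) by (simp add: mult mult_le_one nonneg)
  moreover have "N (r (i mod q)) \<le> 1"
    using assms by simp
  ultimately show ?case
    using ultrametric[of "r (i mod q)"] by (smt (verit) digit_expansion.simps(2))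
qed simp

lemma digit_expansion_first_digit_separated:
  assumes "0 < q" "N t < 1"
    and r_le: "\<And>a. a < q \<Longrightarrow> N (r a) \<le> 1"
    and r_separated: "\<And>a b. a < q \<Longrightarrow> b < q \<Longrightarrow> a \<noteq> b \<Longrightarrow> 1 \<le> N (r a - r b)"
    and "i mod q \<noteq> j mod q"
  shows "1 \<le> N (digit_expansion q t r (Suc M) i - digit_expansion q t r (Suc M) j)"
proof -
  let ?x = "digit_expansion q t r M (i div q)" and ?y = "digit_expansion q t r M (j div q)"
  have "N (?x - ?y) \<le> 1"
    using digit_expansion_le_1[of q t r M] assms(1,2) r_le diff_le[of ?x ?y]
    by (smt (verit))
  then have "N t * N (?x - ?y) < 1"
    using assms(2) nonneg[of t] by (smt (verit) mult_left_le)
  then have "N (t * (?x - ?y)) < 1"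
    by (simp add: mult)
  moreover have "1 \<le> N (r (i mod q) - r (j mod q))"
    using assms by (intro r_separated) auto
  moreover have "r (i mod q) - r (j mod q) =
      (digit_expansion q t r (Suc M) i - digit_expansion q t r (Suc M) j) - t * (?x - ?y)"
    by (simp add: algebra_simps)
  ultimately show ?thesis
    using diff_le[of "digit_expansion q t r (Suc M) i - digit_expansion q t r (Suc M) j"
        "t * (?x - ?y)"]
    by (simp only:)
qed

text \<open>
  If \<open>i\<close> and \<open>j\<close> first differ in digit number \<open>k\<close> or earlier, then dividing off the common lower
  digits leaves numbers with distinct residues.
\<close>

lemma digit_expansion_separated:
  assumes "0 < q" "N t < 1"
    and r_le: "\<And>a. a < q \<Longrightarrow> N (r a) \<le> 1"
    and r_separated: "\<And>a b. a < q \<Longrightarrow> b < q \<Longrightarrow> a \<noteq> b \<Longrightarrow> 1 \<le> N (r a - r b)"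
    and "k < M" "i mod q ^ Suc k \<noteq> j mod q ^ Suc k"
  shows "N t ^ k \<le> N (digit_expansion q t r M i - digit_expansion q t r M j)"
  using assms(5,6)
proof (induction k arbitrary: M i j)
  case (0 M i j)
  then obtain M' where "M = Suc M'"
    using gr0_conv_Suc by blast
  then show ?case
    using digit_expansion_first_digit_separated[OF assms(1-4), where i = i and j = j and M = M'] 0 by simp
next
  case (Suc k M i j)
  then obtain M' where M: "M = Suc M'"
    using gr0_conv_Suc[of M] by auto
  show ?case
  proof (cases "i mod q = j mod q")
    case False
    then have "1 \<le> N (digit_expansion q t r M i - digit_expansion q t r M j)"
      unfolding M using assms(1-4) by (intro digit_expansion_first_digit_separated)
    then show ?thesis
      using assms(2) nonneg[of t] power_le_one[of "N t" "Suc k"] by linarith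
  next
    case True
    have "(i div q) mod q ^ Suc k \<noteq> (j div q) mod q ^ Suc k"
      using Suc.prems(2) True mod_mult2_eq[of _ q "q ^ Suc k"] by auto
    then have "N t ^ k \<le>
        N (digit_expansion q t r M' (i div q) - digit_expansion q t r M' (j div q))"
      using Suc.IH[of M'] Suc.prems(1) M by simp
    then have "N t * N t ^ k \<le>
        N (t * (digit_expansion q t r M' (i div q) - digit_expansion q t r M' (j div q)))"
      unfolding mult using nonneg by (intro mult_left_mono)
    then show ?thesis
      using True by (simp add: M right_diff_distrib)
  qed
qed

text \<open>
  The nodes below \<open>j\<close> lie at index distances \<open>1, \<dots>, j\<close> and those above at
  \<open>1, \<dots>, n - j\<close>, so superadditivity of the sums of multiplicities bounds the product by the same
  quantity for every \<open>j\<close>.  Expansions of length \<open>n\<close> suffice since \<open>multiplicity q d < d\<close> for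
  \<open>d > 0\<close> and \<open>q \<ge> 2\<close>.
\<close>

lemma prod_digit_expansion_differences_ge:
  assumes "2 \<le> q" "0 < N t" "N t < 1"
    and r_le: "\<And>a. a < q \<Longrightarrow> N (r a) \<le> 1"
    and r_separated: "\<And>a b. a < q \<Longrightarrow> b < q \<Longrightarrow> a \<noteq> b \<Longrightarrow> 1 \<le> N (r a - r b)"
    and "j \<le> n"
  defines "x \<equiv> digit_expansion q t r n"
  shows "inj_on x {..n}"
    and "N t ^ (\<Sum>d=1..n. multiplicity q d) \<le> (\<Prod>i\<in>{..n} - {j}. N (x j - x i))"
proof -
  let ?w = "multiplicity q"
  have separated: "N t ^ ?w (l - i) \<le> N (x l - x i)" if "i < l" "l \<le> n" for i l
  proof -
    let ?k = "?w (l - i)"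
    have "?k < q ^ ?k"
      using assms(1) by (intro power_gt_expt) simp
    also have "\<dots> \<le> l - i"
      using that by (intro dvd_imp_le multiplicity_dvd) simp
    finally have "?k < n"
      using that by simp
    moreover have "\<not> q ^ Suc ?k dvd l - i"
      using power_dvd_iff_le_multiplicity[of "l - i" q "Suc ?k"] assms(1) that
      by (simp del: power_Suc)
    then have "l mod q ^ Suc ?k \<noteq> i mod q ^ Suc ?k"
      using that by (metis less_imp_le mod_eq_dvd_iff_nat)
    ultimately show ?thesis
      unfolding x_def using assms by (intro digit_expansion_separated) auto
  qed
  have "x i \<noteq> x l" if "i < l" "l \<le> n" for i l
  proof -
    have "0 < N t ^ ?w (l - i)"
      using assms(2) by simp
    then have "0 < N (x l - x i)"
      using separated[OF that] by linarith
    then show ?thesis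
      by auto
  qed
  then show "inj_on x {..n}"
    by (intro linorder_inj_onI) auto
  have "(\<Sum>d=1..n. ?w d) \<ge> (\<Sum>d=1..j. ?w d) + (\<Sum>d=1..n - j. ?w d)"
    using sum_multiplicity_superadditive[OF assms(1), of j "n - j"] assms(6) by simp
  then have "N t ^ (\<Sum>d=1..n. ?w d) \<le> N t ^ ((\<Sum>d=1..j. ?w d) + (\<Sum>d=1..n - j. ?w d))"
    using assms(2,3) by (intro power_decreasing) auto
  also have "(\<Sum>d=1..j. ?w d) = (\<Sum>i<j. ?w (j - i))"
    by (rule sum.reindex_bij_witness[of _ "\<lambda>i. j - i" "\<lambda>d. j - d"]) auto
  also have "(\<Sum>d=1..n - j. ?w d) = (\<Sum>i\<in>{j<..n}. ?w (i - j))"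
    by (rule sum.reindex_bij_witness[of _ "\<lambda>i. i - j" "\<lambda>d. d + j"]) auto
  also have "N t ^ ((\<Sum>i<j. ?w (j - i)) + (\<Sum>i\<in>{j<..n}. ?w (i - j))) =
      (\<Prod>i<j. N t ^ ?w (j - i)) * (\<Prod>i\<in>{j<..n}. N t ^ ?w (i - j))"
    by (simp add: power_add power_sum)
  also have "\<dots> \<le> (\<Prod>i<j. N (x j - x i)) * (\<Prod>i\<in>{j<..n}. N (x i - x j))"
    using separated assms(6) nonneg by (intro mult_mono prod_mono prod_nonneg) auto
  also have "(\<Prod>i\<in>{j<..n}. N (x i - x j)) = (\<Prod>i\<in>{j<..n}. N (x j - x i))"
    using minus[of "x _ - x j"] by simp
  also have "(\<Prod>i<j. N (x j - x i)) * (\<Prod>i\<in>{j<..n}. N (x j - x i)) =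
      (\<Prod>i\<in>{..<j} \<union> {j<..n}. N (x j - x i))"
    by (rule prod.union_disjoint[symmetric]) auto
  also have "{..<j} \<union> {j<..n} = {..n} - {j}"
    using assms(6) by auto
  finally show "N t ^ (\<Sum>d=1..n. ?w d) \<le> (\<Prod>i\<in>{..n} - {j}. N (x j - x i))" .
qed

text \<open>
  Upper and lower bound for the divided difference at the digit expansions of \<open>0, \<dots>, n\<close>, which
  all lie in \<open>R\<close> because the digits and \<open>t\<close> do.
\<close>

theorem polynomial_small_values_bound:
  assumes "2 \<le> q" "0 < N t" "N t < 1"
    and "0 \<in> R" "t \<in> R" "\<And>x. x \<in> R \<Longrightarrow> N x \<le> 1"
    and R_add: "\<And>x y. x \<in> R \<Longrightarrow> y \<in> R \<Longrightarrow> x + y \<in> R"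
    and R_mult: "\<And>x y. x \<in> R \<Longrightarrow> y \<in> R \<Longrightarrow> x * y \<in> R"
    and r_mem: "\<And>a. a < q \<Longrightarrow> r a \<in> R"
    and r_separated: "\<And>a b. a < q \<Longrightarrow> b < q \<Longrightarrow> a \<noteq> b \<Longrightarrow> 1 \<le> N (r a - r b)"
    and "n \<le> M" "N (c n) = 1" "\<And>i. n < i \<Longrightarrow> i \<le> M \<Longrightarrow> N (c i) < 1"
    and small: "\<And>x. x \<in> R \<Longrightarrow> N (\<Sum>i\<le>M. c i * x ^ i) \<le> N t ^ s"
  shows "s \<le> (\<Sum>d=1..n. multiplicity q d)"
proof -
  define x where "x = digit_expansion q t r n"
  let ?h = "\<Sum>d=1..n. multiplicity q d" and ?S = "x ` {..n}"
    and ?P = "\<lambda>y. \<Sum>i\<le>M. c i * y ^ i"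
  have x_mem: "x i \<in> R" for i
    unfolding x_def
    by (rule digit_expansion_closed[OF _ assms(4,5) r_mem R_add R_mult]) (use assms(1) in auto)
  have r_le: "N (r a) \<le> 1" if "a < q" for a
    using assms(6) r_mem that by blast
  note nodes = prod_digit_expansion_differences_ge[where q = q and t = t and r = r and n = n,
      OF assms(1-3) r_le r_separated, folded x_def]
  have inj: "inj_on x {..n}"
    using nodes(1)[where j = 0] by simp
  have "N (?P y / (\<Prod>z\<in>?S - {y}. y - z)) \<le> N t ^ s / N t ^ ?h" if "y \<in> ?S" for y
  proof -
    from that obtain j where j: "j \<le> n" "y = x j"
      by auto
    have "?S - {y} = x ` ({..n} - {j})"
      using inj j by (auto simp: inj_on_def)
    moreover have "inj_on x ({..n} - {j})"
      using inj by (rule inj_on_subset) auto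
    ultimately have "N (\<Prod>z\<in>?S - {y}. y - z) = (\<Prod>i\<in>{..n} - {j}. N (x j - x i))"
      using j by (simp add: prod prod.reindex)
    also have "\<dots> \<ge> N t ^ ?h"
      using nodes(2) j by blast
    finally show ?thesis
      unfolding divide using small[OF x_mem[of j]] j assms(2) nonneg
      by (intro frac_le) auto
  qed
  then have "N (divided_difference ?S ?P) \<le> N t ^ s / N t ^ ?h"
    unfolding divided_difference_def using assms(2) by (intro sum_le) auto
  moreover have "1 \<le> N (divided_difference ?S ?P)"
    using card_image[OF inj] assms(6) x_mem
    by (intro divided_difference_polynomial_ge_1[where n = n] assms(11-13)) auto
  ultimately have "1 \<le> N t ^ s / N t ^ ?h"
    by linarith
  then have "N t ^ ?h \<le> N t ^ s"
    using assms(2) by (simp add: le_divide_eq)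
  then show ?thesis
    using assms(2,3) by (simp add: power_decreasing_iff)
qed

end

section \<open>The size of the residue field\<close>

text \<open>
  Adjoining a vector \<open>v\<close> outside of \<open>E\<close> multiplies the number of elements by \<open>p\<close>: the translates
  of \<open>E\<close> by \<open>0, v, \<dots>, (p - 1) v\<close> are disjoint, as \<open>k v \<in> E\<close> for \<open>k\<close> prime to \<open>p\<close> would give
  \<open>v \<in> E\<close> by Bezout.  That \<open>E\<close> is an additive subgroup is part of the induction.
\<close>

lemma (in ring) dimension_over_prime_field_imp_many_elements:
  assumes p: "Factorial_Ring.prime p" and char_p: "[int p] \<cdot> \<one> = \<zero>"
    and "dimension n F E" "F = range (\<lambda>k::int. [k] \<cdot> \<one>)"
  shows "subgroup E (add_monoid R) \<and> (\<exists>T\<subseteq>E. finite T \<and> card T = p ^ n)"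
  using assms(3,4)
proof (induction rule: dimension.induct)
  case zero_dim
  have "subgroup {\<zero>} (add_monoid R)"
    by (rule add.subgroupI) auto
  then show ?case
    by (intro conjI exI[of _ "{\<zero>}"]) auto
next
  case (Suc_dim v E n K)
  then obtain T where E: "subgroup E (add_monoid R)"
    and T: "T \<subseteq> E" "finite T" "card T = p ^ n"
    by auto
  have E_carrier: "x \<in> carrier R" if "x \<in> E" for x
    using subgroup.subset[OF E] that by auto
  have scalar: "[k] \<cdot> \<one> \<otimes> v = [k] \<cdot> v" for k :: int
    using Suc_dim.hyps(1) by (simp add: add_pow_ldistr_int)
  have mem_iff: "u \<in> line_extension K v E \<longleftrightarrow> (\<exists>k::int. \<exists>e\<in>E. u = [k] \<cdot> v \<oplus> e)" for u
    using Suc_dim.prems by (auto simp: line_extension_mem_iff scalar)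
  have multiple_closed: "[k] \<cdot> x \<in> E" if "x \<in> E" for x and k :: int
    using add.subgroup_int_pow_closed[OF E that] .
  have "subgroup (line_extension K v E) (add_monoid R)"
  proof (rule add.subgroupI)
    show "line_extension K v E \<subseteq> carrier R"
      using Suc_dim.hyps(1) E_carrier by (auto simp: mem_iff)
    show "line_extension K v E \<noteq> {}"
      using mem_iff subgroup.one_closed[OF E] by auto
  next
    fix a assume "a \<in> line_extension K v E"
    then obtain k :: int and e where a: "a = [k] \<cdot> v \<oplus> e" "e \<in> E"
      by (auto simp: mem_iff)
    have "\<ominus> a = [(- k)] \<cdot> v \<oplus> (\<ominus> e)"
      using a Suc_dim.hyps(1) E_carrier by (simp add: minus_add add.int_pow_neg)
    moreover have "\<ominus> e \<in> E"
      using a(2) add.subgroupE(3)[OF E] by simp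
    ultimately show "\<ominus> a \<in> line_extension K v E"
      by (auto simp: mem_iff)
  next
    fix a b assume "a \<in> line_extension K v E" "b \<in> line_extension K v E"
    then obtain k l :: int and e e' where ab: "a = [k] \<cdot> v \<oplus> e" "e \<in> E" "b = [l] \<cdot> v \<oplus> e'" "e' \<in> E"
      by (auto simp: mem_iff)
    have "a \<oplus> b = [(k + l)] \<cdot> v \<oplus> (e \<oplus> e')"
      using ab Suc_dim.hyps(1) E_carrier by (simp add: add.int_pow_mult a_ac)
    moreover have "e \<oplus> e' \<in> E"
      using ab add.subgroupE(4)[OF E] by simp
    ultimately show "a \<oplus> b \<in> line_extension K v E"
      by (auto simp: mem_iff)
  qed
  moreover have "\<exists>T'\<subseteq>line_extension K v E. finite T' \<and> card T' = p ^ Suc n"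
  proof -
    have p_v: "[int p] \<cdot> v = \<zero>"
      using scalar[of "int p"] Suc_dim.hyps(1) by (simp add: char_p)
    have not_in_E: "[k] \<cdot> v \<notin> E" if "\<not> int p dvd k" for k :: int
    proof
      assume "[k] \<cdot> v \<in> E"
      have "coprime k (int p)"
        using p that by (metis coprime_commute prime_imp_coprime prime_nat_int_transfer)
      then obtain a b where "a * k + b * int p = 1"
        by (metis bezout_int coprime_iff_gcd_eq_1)
      then have "v = [(k * a + int p * b)] \<cdot> v"
        using Suc_dim.hyps(1) by (simp add: mult.commute)
      also have "\<dots> = [a] \<cdot> ([k] \<cdot> v) \<oplus> [b] \<cdot> ([int p] \<cdot> v)"
        using Suc_dim.hyps(1) by (simp add: add.int_pow_mult add.int_pow_pow)
      also have "\<dots> = [a] \<cdot> ([k] \<cdot> v)"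
        using Suc_dim.hyps(1) by (simp add: p_v)
      finally show False
        using multiple_closed[OF \<open>[k] \<cdot> v \<in> E\<close>, of a] Suc_dim.hyps(2) by simp
    qed
    define g where "g = (\<lambda>(k, e). [int k] \<cdot> v \<oplus> e)"
    have "inj_on g ({..<p} \<times> T)"
    proof (rule inj_onI, clarify)
      fix k e l e' assume *: "k < p" "l < p" "e \<in> T" "e' \<in> T" "g (k, e) = g (l, e')"
      have carr: "e \<in> carrier R" "e' \<in> carrier R" "v \<in> carrier R"
        using * T(1) E_carrier Suc_dim.hyps(1) by auto
      have cancel: "x \<ominus> y = e' \<ominus> e"
        if "x \<in> carrier R" "y \<in> carrier R" "x \<oplus> e = y \<oplus> e'" for x y
      proof -
        have "x \<ominus> y = (x \<oplus> e) \<ominus> e \<ominus> y"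
          using that(1,2) carr by algebra
        also have "\<dots> = e' \<ominus> e"
          unfolding that(3) using that(1,2) carr by algebra
        finally show ?thesis .
      qed
      have "[(int k - int l)] \<cdot> v = [int k] \<cdot> v \<ominus> [int l] \<cdot> v"
        using carr add.int_pow_diff[of v "int k" "int l"] by (simp add: a_minus_def)
      then have diff: "[(int k - int l)] \<cdot> v = e' \<ominus> e"
        using cancel[of "[int k] \<cdot> v" "[int l] \<cdot> v"] carr * by (simp add: g_def)
      have "e' \<ominus> e \<in> E"
        unfolding a_minus_def
        using * T(1) add.subgroupE(3,4)[OF E] by blast
      then have "int p dvd int k - int l"
        using diff not_in_E by metis
      then have "int k mod int p = int l mod int p"
        by (simp add: mod_eq_dvd_iff)
      then have "k = l"
        using * by simp
      then have "e' \<ominus> e = \<zero>"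
        using diff carr by (simp add: add_pow_int_ge)
      then show "k = l \<and> e = e'"
        using \<open>k = l\<close> carr by (simp add: r_right_minus_eq)
    qed
    then have "card (g ` ({..<p} \<times> T)) = p ^ Suc n"
      using T by (simp add: card_image)
    moreover have "g ` ({..<p} \<times> T) \<subseteq> line_extension K v E"
    proof clarify
      fix k e assume "e \<in> T"
      then show "g (k, e) \<in> line_extension K v E"
        unfolding g_def mem_iff using T(1) by auto
    qed
    ultimately show ?thesis
      using T(2) by blast
  qed
  ultimately show ?case ..
qed

locale nonarchimedean_subfield =
  nonarchimedean_absolute_value "absval :: 'c \<Rightarrow> real"
  for K :: "'c::{field_char_0,metric_space} set" +
  assumes subfield: "subfield K ring_of_type_algebra"
begin

lemma ambient_ring: "ring (ring_of_type_algebra :: 'c ring)"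
  by (rule ring_from_type_algebra)

lemma ring_of_type_algebra_simps [simp]:
  "carrier (ring_of_type_algebra :: 'c ring) = UNIV"
  "monoid.mult (ring_of_type_algebra :: 'c ring) = (*)"
  "one (ring_of_type_algebra :: 'c ring) = 1"
  "zero (ring_of_type_algebra :: 'c ring) = 0"
  "add (ring_of_type_algebra :: 'c ring) = (+)"
  by (simp_all add: ring_of_type_algebra_def)

lemma ambient_minus [simp]: "\<ominus>\<^bsub>(ring_of_type_algebra :: 'c ring)\<^esub> x = - x"
proof -
  interpret ring "ring_of_type_algebra :: 'c ring"
    by (rule ambient_ring)
  show ?thesis
    using minus_equality[of "- x" x] by simp
qed

lemma K_closed:
  "0 \<in> K" "1 \<in> K" "x \<in> K \<Longrightarrow> - x \<in> K"
  "x \<in> K \<Longrightarrow> y \<in> K \<Longrightarrow> x + y \<in> K" "x \<in> K \<Longrightarrow> y \<in> K \<Longrightarrow> x * y \<in> K"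
  using subringE[OF subfieldE(1)[OF subfield]] by simp_all

lemma integers_closed:
  "0 \<in> integers_of K" "1 \<in> integers_of K" "x \<in> integers_of K \<Longrightarrow> - x \<in> integers_of K"
  "x \<in> integers_of K \<Longrightarrow> y \<in> integers_of K \<Longrightarrow> x + y \<in> integers_of K"
  "x \<in> integers_of K \<Longrightarrow> y \<in> integers_of K \<Longrightarrow> x * y \<in> integers_of K"
  using ultrametric[of x y]
  by (auto simp: integers_of_def K_closed mult mult_le_one nonneg)

lemma of_nat_mem_integers: "of_nat n \<in> integers_of K"
  by (induction n) (simp_all add: integers_closed)

lemma integer_ring_simps [simp]:
  "carrier (integer_ring K) = integers_of K"
  "monoid.mult (integer_ring K) = (*)"
  "one (integer_ring K) = 1"
  "zero (integer_ring K) = 0"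
  "add (integer_ring K) = (+)"
  by (simp_all add: integer_ring_def)

lemma ring_integer_ring: "ring (integer_ring K)"
proof -
  interpret ring "ring_of_type_algebra :: 'c ring"
    by (rule ambient_ring)
  have "subring (integers_of K) ring_of_type_algebra"
    by (rule subringI) (auto simp: integers_closed)
  then show ?thesis
    unfolding integer_ring_def by (rule subring_is_ring)
qed

lemma integer_ring_minus:
  assumes "x \<in> integers_of K"
  shows "\<ominus>\<^bsub>integer_ring K\<^esub> x = - x"
proof -
  interpret ring "integer_ring K"
    by (rule ring_integer_ring)
  show ?thesis
    using minus_equality[of "- x" x] assms by (simp add: integers_closed)
qed

lemma ideal_maximal_ideal: "ideal (maximal_ideal_of K) (integer_ring K)"
proof (rule idealI[OF ring_integer_ring])
  interpret ring "integer_ring K"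
    by (rule ring_integer_ring)
  show "subgroup (maximal_ideal_of K) (add_monoid (integer_ring K))"
  proof (rule add.subgroupI)
    show "maximal_ideal_of K \<subseteq> carrier (integer_ring K)"
      by (auto simp: maximal_ideal_of_def integers_of_def)
    show "maximal_ideal_of K \<noteq> {}"
      using K_closed(1) by (auto simp: maximal_ideal_of_def intro!: exI[of _ 0])
  next
    fix a assume a: "a \<in> maximal_ideal_of K"
    then have "a \<in> integers_of K"
      by (auto simp: maximal_ideal_of_def integers_of_def)
    then show "\<ominus>\<^bsub>integer_ring K\<^esub> a \<in> maximal_ideal_of K"
      using a by (simp add: integer_ring_minus) (simp add: maximal_ideal_of_def K_closed)
  next
    fix a b assume "a \<in> maximal_ideal_of K" "b \<in> maximal_ideal_of K"
    then show "a \<oplus>\<^bsub>integer_ring K\<^esub> b \<in> maximal_ideal_of K"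
      using ultrametric[of a b] by (auto simp: maximal_ideal_of_def K_closed)
  qed
next
  fix a x assume *: "a \<in> maximal_ideal_of K" "x \<in> carrier (integer_ring K)"
  then have "absval x * absval a \<le> 1 * absval a"
    by (intro mult_right_mono nonneg) (simp add: integers_of_def)
  then have "absval (x * a) < 1"
    using * by (simp add: mult maximal_ideal_of_def)
  then show "x \<otimes>\<^bsub>integer_ring K\<^esub> a \<in> maximal_ideal_of K"
    and "a \<otimes>\<^bsub>integer_ring K\<^esub> x \<in> maximal_ideal_of K"
    using * by (simp_all add: maximal_ideal_of_def integers_of_def K_closed mult.commute)
qed

text \<open>
  The prime \<open>p\<close> vanishes in the residue field, so dimension \<open>f\<close> over the image of the integers
  gives \<open>p ^ f\<close> distinct classes.  Elements of distinct classes differ by an integer outside of the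
  maximal ideal.  The dimension is positive because 1 is not in that ideal; otherwise
  \<open>alpha p f j\<close> would be a divergent sum for \<open>j > 0\<close>.
\<close>

lemma residue_representatives:
  assumes "Factorial_Ring.prime p" "absval (of_nat p :: 'c) < 1" "has_residue_degree K f"
  shows "0 < f"
    and "\<exists>r. (\<forall>a<p ^ f. r a \<in> integers_of K) \<and>
      (\<forall>a<p ^ f. \<forall>b<p ^ f. a \<noteq> b \<longrightarrow> 1 \<le> absval (r a - r b))"
proof -
  let ?A = "integer_ring K" and ?m = "maximal_ideal_of K" and ?F = "residue_field K"
  interpret A: ring ?A
    by (rule ring_integer_ring)
  interpret m: ideal ?m ?A
    by (rule ideal_maximal_ideal)
  interpret F: ring ?F
    unfolding residue_field_def by (rule m.quotient_is_ring)
  let ?cl = "\<lambda>x. ?m +>\<^bsub>?A\<^esub> x"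
  have F_carrier: "carrier ?F = ?cl ` integers_of K"
    by (auto simp: residue_field_def FactRing_def A_RCOSETS_def')
  have F_simps: "one ?F = ?cl 1" "zero ?F = ?m" "add ?F = set_add ?A"
    by (simp_all add: residue_field_def FactRing_def)
  have cl_eq_iff: "?cl x = ?cl y \<longleftrightarrow> absval (x - y) < 1"
    if "x \<in> integers_of K" "y \<in> integers_of K" for x y
  proof -
    have "?cl x = ?cl y \<longleftrightarrow> x - y \<in> ?m"
      using A.quotient_eq_iff_same_a_r_cos[OF ideal_maximal_ideal, of x y] that
      by (simp add: a_minus_def integer_ring_minus)
    moreover have "x - y \<in> K"
      using that K_closed(4)[of x "- y"] by (simp add: integers_of_def K_closed)
    ultimately show ?thesis
      by (simp add: maximal_ideal_of_def)
  qed
  have cl_0: "?cl 0 = ?m"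
    using m.a_rcos_const[of 0] m.zero_closed by simp
  have multiple_one: "[n] \<cdot>\<^bsub>?F\<^esub> \<one>\<^bsub>?F\<^esub> = ?cl (of_nat n)" for n :: nat
  proof (induction n)
    case 0
    then show ?case
      using F.add.nat_pow_0 by (simp add: F_simps cl_0)
  next
    case (Suc n)
    have "[Suc n] \<cdot>\<^bsub>?F\<^esub> \<one>\<^bsub>?F\<^esub> = [n] \<cdot>\<^bsub>?F\<^esub> \<one>\<^bsub>?F\<^esub> \<oplus>\<^bsub>?F\<^esub> \<one>\<^bsub>?F\<^esub>"
      using F.add.nat_pow_Suc by simp
    also have "\<dots> = ?cl (of_nat n + 1)"
      unfolding Suc using m.a_rcos_sum[of "of_nat n" 1]
      by (simp add: F_simps of_nat_mem_integers integers_closed)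
    finally show ?case
      by (simp add: add.commute)
  qed
  have "[int p] \<cdot>\<^bsub>?F\<^esub> \<one>\<^bsub>?F\<^esub> = ?cl (of_nat p)"
    by (simp add: add_pow_int_ge multiple_one)
  also have "\<dots> = \<zero>\<^bsub>?F\<^esub>"
    using cl_eq_iff[of "of_nat p" 0] assms(2)
    by (simp add: F_simps cl_0 of_nat_mem_integers integers_closed)
  finally have char_p: "[int p] \<cdot>\<^bsub>?F\<^esub> \<one>\<^bsub>?F\<^esub> = \<zero>\<^bsub>?F\<^esub>" .
  have one_neq_zero: "\<one>\<^bsub>?F\<^esub> \<noteq> \<zero>\<^bsub>?F\<^esub>"
    using cl_eq_iff[of 1 0] by (simp add: F_simps cl_0 integers_closed)
  note dim = assms(3)[unfolded has_residue_degree_def]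
  show "0 < f"
  proof (rule ccontr)
    assume "\<not> 0 < f"
    then have "carrier ?F = {\<zero>\<^bsub>?F\<^esub>}"
      using dim by (auto elim: F.dimension.cases)
    then show False
      using one_neq_zero F.one_closed by simp
  qed
  obtain T where T: "T \<subseteq> carrier ?F" "finite T" "card T = p ^ f"
    using F.dimension_over_prime_field_imp_many_elements[OF assms(1) char_p dim refl] by blast
  obtain h where h: "bij_betw h {..<p ^ f} T"
    using ex_bij_betw_nat_finite[OF T(2)] T(3) by (auto simp: atLeast0LessThan)
  have "\<forall>a<p ^ f. \<exists>x. x \<in> integers_of K \<and> h a = ?cl x"
    using bij_betwE[OF h] T(1) unfolding F_carrier by blast
  then obtain r where r: "\<And>a. a < p ^ f \<Longrightarrow> r a \<in> integers_of K \<and> h a = ?cl (r a)"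
    by metis
  have "1 \<le> absval (r a - r b)" if "a < p ^ f" "b < p ^ f" "a \<noteq> b" for a b
  proof -
    have "h a \<noteq> h b"
      using that bij_betw_imp_inj_on[OF h] by (auto simp: inj_on_def)
    then show ?thesis
      using cl_eq_iff[of "r a" "r b"] r that by force
  qed
  then show "\<exists>r. (\<forall>a<p ^ f. r a \<in> integers_of K) \<and>
      (\<forall>a<p ^ f. \<forall>b<p ^ f. a \<noteq> b \<longrightarrow> 1 \<le> absval (r a - r b))"
    using r by blast
qed

text \<open>
  The definition of a uniformizer admits \<open>\<pi> = 0\<close> when the absolute value on \<open>K\<close> is trivial; the
  element \<open>x\<close> excludes this.
\<close>

lemma uniformizer_absval:
  assumes "uniformizer K \<pi>" "x \<in> K" "x \<noteq> 0" "absval x < 1"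
  shows "0 < absval \<pi>" "absval \<pi> < 1"
proof -
  have m: "maximal_ideal_of K = {\<pi> * z | z. z \<in> integers_of K}"
    using assms(1) by (simp add: uniformizer_def)
  have "x \<in> maximal_ideal_of K"
    using assms by (simp add: maximal_ideal_of_def)
  then have "\<pi> \<noteq> 0"
    using m assms(3) by auto
  then show "0 < absval \<pi>"
    using nonneg[of \<pi>] eq_zero_iff[of \<pi>] by simp
  have "\<pi> * 1 \<in> maximal_ideal_of K"
    unfolding m using integers_closed(2) by blast
  then show "absval \<pi> < 1"
    by (simp add: maximal_ideal_of_def)
qed

lemma dvd_in_integers_imp_absval_le:
  assumes "dvd_in_integers K a y"
  shows "absval y \<le> absval a"
  using assms mult_left_mono[OF _ nonneg[of a]]
  by (force simp: dvd_in_integers_def integers_of_def mult)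

lemma absval_Units:
  assumes "u \<in> Units (integer_ring K)"
  shows "absval u = 1"
proof -
  obtain v where "absval u \<le> 1" "absval v \<le> 1" "u * v = 1"
    using assms by (auto simp: Units_def integers_of_def)
  then have "1 = absval u * absval v"
    by (metis mult one)
  also have "\<dots> \<le> absval u * 1"
    using \<open>absval v \<le> 1\<close> by (intro mult_left_mono nonneg)
  finally show ?thesis
    using \<open>absval u \<le> 1\<close> by simp
qed

end

section \<open>Power series on the closed unit disc\<close>

lemma vp_le_iff:
  fixes x y :: "'c::{zero,metric_space}"
  assumes "1 < p"
  shows "vp p x \<le> vp p y \<longleftrightarrow> absval y \<le> absval x"
proof -
  have "0 < absval z \<longleftrightarrow> z \<noteq> 0" and [simp]: "absval (0::'c) = 0" for z :: 'c
    by (simp_all add: absval_def)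
  then show ?thesis
    using assms by (auto simp: vp_def not_le less_imp_le)
qed

locale nonarchimedean_metric = nonarchimedean_absolute_value N
  for N :: "'c::{field_char_0,metric_space} \<Rightarrow> real" +
  assumes dist_eq: "dist x y = N (x - y)"
begin

lemma absval_eq: "absval = N"
  by (rule ext) (simp add: absval_def dist_eq)

text \<open>
  The coefficients are the terms of the series at the point 1.
\<close>

lemma coefficients_eventually_small:
  fixes P :: "'c fps"
  assumes "converges_on_unit_disc P" "0 < e"
  obtains M where "\<And>i. M \<le> i \<Longrightarrow> N (fps_nth P i) < e"
proof -
  let ?S = "\<lambda>n. \<Sum>i<n. fps_nth P i"
  have "summable (fps_nth P)"
    using assms(1)[unfolded converges_on_unit_disc_def, rule_format, of 1]
    by (simp add: absval_eq)
  then obtain L where "?S \<longlonglongrightarrow> L"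
    by (auto simp: summable_def sums_def)
  then obtain M where M: "\<And>n. M \<le> n \<Longrightarrow> N (?S n - L) < e"
    using assms(2) by (auto simp: lim_sequentially dist_eq)
  have "N (fps_nth P i) < e" if "M \<le> i" for i
    using M[of i] M[of "Suc i"] that diff_le[of "?S (Suc i) - L" "?S i - L"] by simp
  then show thesis
    using that by blast
qed

lemma absval_truncation_error_le:
  fixes P :: "'c fps"
  assumes "converges_on_unit_disc P" "N x \<le> 1" "0 < B"
    and small: "\<And>i. M < i \<Longrightarrow> N (fps_nth P i) \<le> B"
  shows "N ((\<Sum>i\<le>M. fps_nth P i * x ^ i) - fps_value P x) \<le> B"
proof -
  let ?a = "\<lambda>i. fps_nth P i * x ^ i"
  have "(\<lambda>n. \<Sum>i<n. ?a i) \<longlonglongrightarrow> fps_value P x"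
    using assms(1,2) summable_sums
    by (auto simp: absval_eq converges_on_unit_disc_def fps_value_def sums_def)
  then obtain n where n: "\<And>k. n \<le> k \<Longrightarrow> N ((\<Sum>i<k. ?a i) - fps_value P x) < B"
    using assms(3) by (auto simp: lim_sequentially dist_eq)
  define k where "k = max n (Suc M)"
  have "N (?a i) \<le> B" if "i \<in> {Suc M..<k}" for i
  proof -
    have "N (?a i) \<le> N (fps_nth P i) * 1"
      unfolding mult power using assms(2) by (intro mult_left_mono power_le_one nonneg)
    then show ?thesis
      using small[of i] that by simp
  qed
  then have tail: "N (\<Sum>i\<in>{Suc M..<k}. ?a i) \<le> B"
    using assms(3) by (intro sum_le) auto
  have "(\<Sum>i<k. ?a i) = (\<Sum>i\<le>M. ?a i) + (\<Sum>i\<in>{Suc M..<k}. ?a i)"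
    using sum.atLeastLessThan_concat[of 0 "Suc M" k ?a]
    by (simp add: k_def atLeast0LessThan lessThan_Suc_atMost)
  then have split: "(\<Sum>i\<le>M. ?a i) - fps_value P x =
      ((\<Sum>i<k. ?a i) - fps_value P x) - (\<Sum>i\<in>{Suc M..<k}. ?a i)"
    by simp
  have "N ((\<Sum>i<k. ?a i) - fps_value P x) < B"
    by (rule n) (simp add: k_def)
  then show ?thesis
    unfolding split
    using tail diff_le[of "(\<Sum>i<k. ?a i) - fps_value P x" "\<Sum>i\<in>{Suc M..<k}. ?a i"]
    by linarith
qed

text \<open>
  \<open>Lwideg\<close> is a greatest element, which is meaningful only for a nonempty bounded set.  The
  coefficients tend to 0 and are not all 0, so the largest absolute value is attained, and at finitely many
  indices only.
\<close>

lemma absval_less_beyond_Lwideg: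
  fixes P :: "'c fps"
  assumes "1 < p" "converges_on_unit_disc P" "P \<noteq> 0" "Lwideg p P < i"
  shows "N (fps_nth P i) < N (fps_nth P (Lwideg p P))"
proof -
  let ?a = "\<lambda>i. N (fps_nth P i)"
  obtain k where k: "fps_nth P k \<noteq> 0"
    using assms(3) by (auto simp: fps_eq_iff)
  then have "0 < ?a k"
    using nonneg[of "fps_nth P k"] eq_zero_iff[of "fps_nth P k"] by simp
  then obtain M where M: "\<And>i. M \<le> i \<Longrightarrow> ?a i < ?a k"
    using coefficients_eventually_small[OF assms(2)] by blast
  then have "k < M"
    by (meson less_irrefl not_le)
  have "Max (?a ` {..M}) \<in> ?a ` {..M}"
    by (intro Max_in) auto
  then obtain m where "?a m = Max (?a ` {..M})"
    by (metis imageE)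
  then have "?a i \<le> ?a m" if "i \<le> M" for i
    using that by simp
  then have m: "?a i \<le> ?a m" for i
    using M[of i] \<open>k < M\<close> by (meson less_imp_le nle_le order_trans)
  have le_iff: "vp p x \<le> vp p y \<longleftrightarrow> N y \<le> N x" for x y :: 'c
    using vp_le_iff[OF assms(1), of x y] by (simp only: absval_eq)
  have "(INF i. vp p (fps_nth P i)) = vp p (fps_nth P m)"
    using m by (intro antisym INF_lower INF_greatest) (simp_all add: le_iff)
  then have minimal_iff: "vp p (fps_nth P j) = (INF i. vp p (fps_nth P i)) \<longleftrightarrow> ?a j = ?a m" for j
    using le_iff[of "fps_nth P j" "fps_nth P m"] le_iff[of "fps_nth P m" "fps_nth P j"]
    by (metis order_antisym order_refl)
  have bound: "j \<le> M" if "?a j = ?a m" for j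
    using M[of j] m[of k] that by linarith
  have Lwideg_eq: "Lwideg p P = (GREATEST j. ?a j = ?a m)"
    by (simp add: Lwideg_def minimal_iff)
  have "?a (Lwideg p P) = ?a m"
    unfolding Lwideg_eq by (rule GreatestI_nat[of _ m M]) (auto intro: bound)
  moreover have "?a i \<noteq> ?a m"
  proof
    assume "?a i = ?a m"
    then have "i \<le> Lwideg p P"
      unfolding Lwideg_eq by (rule Greatest_le_nat[where b = M]) (auto intro: bound)
    then show False
      using assms(4) by simp
  qed
  ultimately show ?thesis
    using m[of i] by simp
qed

end

section \<open>The lower bound on degrees\<close>

lemma is_Cp_imp_nonarchimedean:
  assumes "is_Cp p TYPE('c::{field_char_0,complete_space})"
  shows "nonarchimedean_absolute_value (absval :: 'c \<Rightarrow> real)"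
  using assms by unfold_locales (auto simp: is_Cp_def absval_def)

lemma is_Cp_imp_nonarchimedean_metric:
  assumes "is_Cp p TYPE('c::{field_char_0,complete_space})"
  shows "nonarchimedean_metric (absval :: 'c \<Rightarrow> real)"
  using assms
  by (intro nonarchimedean_metric.intro nonarchimedean_metric_axioms.intro
      is_Cp_imp_nonarchimedean) (auto simp: is_Cp_def)

lemma absval_of_nat_prime:
  assumes "is_Cp p TYPE('c::{field_char_0,complete_space})" "Factorial_Ring.prime p"
  shows "absval (of_nat p :: 'c) = 1 / real p"
proof -
  have "absval (of_nat p :: 'c) = padic_abs_rat p (of_nat p)"
    using assms(1) by (metis is_Cp_def of_rat_of_nat_eq)
  also have "\<dots> = real p powi (- 1)"
    using assms(2) prime_gt_0_nat[OF assms(2)] prime_gt_1_nat[OF assms(2)]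
    by (simp add: padic_abs_rat_def Rat.of_int_def quotient_of_int multiplicity_self)
  finally show ?thesis
    by (simp add: field_simps power_int_minus)
qed

theorem theorem3p6:
  fixes p f s :: nat
    and K :: "'c::{field_char_0,complete_space} set"
    and \<pi> :: 'c
  assumes "Factorial_Ring.prime p"
    and "is_Cp p TYPE('c)"
    and "finite_extension_of_Qp K"
    and "has_residue_degree K f"
    and "uniformizer K \<pi>"
  shows "(\<forall>(P :: 'c poly) n.
            (\<forall>i. poly.coeff P i \<in> K) \<and> Polynomial.degree P = n \<and> Polynomial.lead_coeff P = 1 \<and>
            (\<forall>x \<in> integers_of K. dvd_in_integers K (\<pi> ^ s) (poly P x))
            \<longrightarrow> n \<ge> beta p f s) \<and>
         (\<forall>P :: 'c fps.
            (\<forall>i. fps_nth P i \<in> K) \<and> converges_on_unit_disc P \<and>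
            (\<forall>x \<in> integers_of K. dvd_in_integers K (\<pi> ^ s) (fps_value P x)) \<and>
            fps_nth P (Lwideg p P) \<in> Units (integer_ring K)
            \<longrightarrow> Lwideg p P \<ge> beta p f s)"
proof -
  interpret nonarchimedean_metric "absval :: 'c \<Rightarrow> real"
    using assms(2) by (rule is_Cp_imp_nonarchimedean_metric)
  interpret nonarchimedean_subfield K
    using assms(3)
    by (intro nonarchimedean_subfield.intro nonarchimedean_subfield_axioms.intro nonarchimedean_absolute_value_axioms)
      (simp add: finite_extension_of_Qp_def)
  have p: "1 < p"
    using assms(1) by (rule prime_gt_1_nat)
  have p_abs: "absval (of_nat p :: 'c) < 1"
    using absval_of_nat_prime[OF assms(2,1)] p by simp
  obtain r where f: "0 < f"
    and r: "\<And>a. a < p ^ f \<Longrightarrow> r a \<in> integers_of K"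
      "\<And>a b. a < p ^ f \<Longrightarrow> b < p ^ f \<Longrightarrow> a \<noteq> b \<Longrightarrow> 1 \<le> absval (r a - r b)"
    using residue_representatives[OF assms(1) p_abs assms(4)] by metis
  have q: "2 \<le> p ^ f"
    using p f self_le_power[of p f] by linarith
  have \<pi>_abs: "0 < absval \<pi>" "absval \<pi> < 1"
    using uniformizer_absval[OF assms(5), of "of_nat p"] p_abs p of_nat_mem_integers[of p]
    by (auto simp: integers_of_def)
  have \<pi>_mem: "\<pi> \<in> integers_of K"
    using assms(5) by (simp add: uniformizer_def)
  \<comment> \<open>The two parts of the theorem differ only in the \<open>n\<close>, \<open>M\<close> and \<open>c\<close> to which they apply this.\<close>
  have key: "beta p f s \<le> n"
    if "n \<le> M" "absval (c n) = 1" "\<And>i. n < i \<Longrightarrow> i \<le> M \<Longrightarrow> absval (c i) < 1"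
      "\<And>x. x \<in> integers_of K \<Longrightarrow> absval (\<Sum>i\<le>M. c i * x ^ i) \<le> absval \<pi> ^ s"
    for n M :: nat and c :: "nat \<Rightarrow> 'c"
  proof -
    have "s \<le> (\<Sum>d=1..n. multiplicity (p ^ f) d)"
      by (rule polynomial_small_values_bound[OF q \<pi>_abs integers_closed(1) \<pi>_mem _
            integers_closed(4,5) r that]) (auto simp: integers_of_def)
    then show ?thesis
      unfolding beta_def alpha_eq_sum_multiplicity[OF q, symmetric] by (rule Least_le)
  qed
  have "beta p f s \<le> Polynomial.degree P"
    if "Polynomial.lead_coeff P = 1"
      "\<forall>x \<in> integers_of K. dvd_in_integers K (\<pi> ^ s) (poly P x)" for P :: "'c poly"
  proof (rule key[of _ "Polynomial.degree P" "poly.coeff P"])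
    fix x assume "x \<in> integers_of K"
    then show "absval (\<Sum>i\<le>Polynomial.degree P. poly.coeff P i * x ^ i) \<le> absval \<pi> ^ s"
      using dvd_in_integers_imp_absval_le[of "\<pi> ^ s" "poly P x"] that(2)
      by (simp add: power poly_altdef)
  qed (use that(1) in auto)
  moreover have "beta p f s \<le> Lwideg p P"
    if P: "converges_on_unit_disc P"
      "\<forall>x \<in> integers_of K. dvd_in_integers K (\<pi> ^ s) (fps_value P x)"
      and unit: "fps_nth P (Lwideg p P) \<in> Units (integer_ring K)" for P :: "'c fps"
  proof -
    have lead: "absval (fps_nth P (Lwideg p P)) = 1"
      using unit by (rule absval_Units)
    then have "P \<noteq> 0"
      by auto
    obtain M0 where M0: "\<And>i. M0 \<le> i \<Longrightarrow> absval (fps_nth P i) < absval \<pi> ^ s"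
      using coefficients_eventually_small[OF P(1), of "absval \<pi> ^ s"] \<pi>_abs by auto
    \<comment> \<open>Beyond \<open>M0\<close> the coefficients are so small that dropping them keeps the values divisible.\<close>
    let ?M = "max M0 (Lwideg p P)"
    show ?thesis
    proof (rule key[of _ ?M "fps_nth P"])
      show "absval (fps_nth P i) < 1" if "Lwideg p P < i" for i
        using absval_less_beyond_Lwideg[OF p P(1) \<open>P \<noteq> 0\<close> that] lead by simp
    next
      fix x assume x: "x \<in> integers_of K"
      let ?t = "\<Sum>i\<le>?M. fps_nth P i * x ^ i"
      have "absval (?t - fps_value P x) \<le> absval \<pi> ^ s"
      proof (rule absval_truncation_error_le[OF P(1)])
        show "absval x \<le> 1"
          using x by (simp add: integers_of_def)
        show "0 < absval \<pi> ^ s"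
          using \<pi>_abs by simp
        show "absval (fps_nth P i) \<le> absval \<pi> ^ s" if "?M < i" for i
          using M0[of i] that by simp
      qed
      moreover have "absval (fps_value P x) \<le> absval \<pi> ^ s"
        using dvd_in_integers_imp_absval_le[of "\<pi> ^ s" "fps_value P x"] P(2) x
        by (simp add: power)
      ultimately show "absval ?t \<le> absval \<pi> ^ s"
        using ultrametric[of "?t - fps_value P x" "fps_value P x"] by simp
    qed (use lead in auto)
  qed
  ultimately show ?thesis
    by blast
qed

end
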